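(* Let $n\ge 1$, $d\ge 2$, let $\mathbf{X}\in\mathbb{R}^{n\times d}$ be a matrix with rows $\mathbf{x}_1^T,\dots,\mathbf{x}_n^T$ whose columns are normalized, i.e. $\sum_{i=1}^n X_{ij}^2=1$ for all $j\in\{1,\dots,d\}$, and let $y_1,\dots,y_n$ be labels. Let $\beta>0$ and let $\ell(\hat y,y)$ be a loss function that is convex and twice differentiable in its first argument, with second derivative (with respect to the first argument) $\ell''(\hat y,y)\le\beta$ for all $\hat y,y$. Let $$F(\mathbf{w})=\sum_{i=1}^n \ell(\mathbf{x}_i^T\mathbf{w},y_i),\qquad \mathbf{w}\in\mathbb{R}^d,$$ and suppose $F$ admits a minimizer $\mathbf{w}^*$. Let $\rho$ be the spectral radius of $\mathbf{X}^T\mathbf{X}$, let $P\in\{1,\dots,d\}$ and $\eta>0$, and put $\sigma=\frac{(P-1)(\rho-1)}{d-1}$. Assume that $$\frac{\eta}{2}(1+\sigma)<1 .$$ Let $(\mathbf{w}_t)_{t\ge1}$ be the sequence produced by the Accelerated Shotgun algorithm (defined in the context) applied to $F$ with parameters $P,\eta,\beta$, with an arbitrary initial point $\mathbf{w}_1=\mathbf{u}_1\in\mathbb{R}^d$, and with constants $$\gamma_t=\frac{1-\theta_t}{\theta_{t+1}},\qquad c_t=\frac{\theta_t}{\theta_{t+1}}\left(1-\frac{2P}{d}\left(1-\frac{\eta}{2}(1+\sigma)\right)\right),$$ where $\theta_0=0$ and $\theta_{t+1}=\frac12\left(1+\sqrt{1+4\theta_t^2}\right)$ for $t\ge 0$.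 Then for every integer $t>1$, $$\mathbb{E}_{S_1,\dots,S_{t-1}}[F(\mathbf{w}_t)]-F(\mathbf{w}^* )\le\frac{\beta d^2\|\mathbf{w}_1-\mathbf{w}^*\|^2}{t^2P^2\,\eta\left(1-\frac{\eta}{2}(1+\sigma)\right)},$$ where $\|\cdot\|$ is the Euclidean norm and the expectation is over the random choices of the subsets $S_1,\dots,S_{t-1}$.
   Context: Accelerated Shotgun algorithm, for a differentiable objective $F:\mathbb{R}^d\to\mathbb{R}$, with parameters $P\in\{1,\dots,d\}$ (number of coordinates updated per iteration), $\eta>0$ (step size coefficient), $\beta>0$ (smoothness parameter), and real constants $\gamma_t,c_t$ ($t\ge1$): initialize $\mathbf{w}_1=\mathbf{u}_1\in\mathbb{R}^d$. For $t=1,2,\dots$: pick a random subset $S_t\subseteq\{1,\dots,d\}$ with $|S_t|=P$, uniformly among all such subsets and independently of $S_1,\dots,S_{t-1}$; for each $j\in\{1,\dots,d\}$ set $$w_{t+1,j}=\begin{cases}u_{t,j}-\frac{\eta}{\beta}\,\nabla F(\mathbf{u}_t)_j & \text{if } j\in S_t,\\ u_{t,j}&\text{otherwise;}\end{cases}$$ then set $$\mathbf{u}_{t+1}=(1-\gamma_t)\mathbf{w}_{t+1}+\gamma_t\mathbf{w}_t+c_t(\mathbf{u}_t-\mathbf{w}_{t+1}).$$ Here $w_{t,j}$, $u_{t,j}$ denote the $j$-th coordinates of $\mathbf{w}_t$, $\mathbf{u}_t$. *)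

theory Defs
  imports "HOL-Probability.Probability"
begin

text \<open>Eigenvalues and spectral radius of a real square matrix. Eigenvalues are taken over the
  complex numbers. There are finitely many of them and at least one, so the supremum is a maximum.\<close>

definition eigenvalues :: "real^'d^'d \<Rightarrow> complex set" where
  "eigenvalues A = {k. \<exists>v :: complex^'d. v \<noteq> 0 \<and> map_matrix complex_of_real A *v v = k *s v}"

definition spectral_radius :: "real^'d^'d \<Rightarrow> real" where
  "spectral_radius A = (SUP k\<in>eigenvalues A. cmod k)"

text \<open>The gradient is meaningful only at points of differentiability.\<close>

definition gradient :: "(real^'d \<Rightarrow> real) \<Rightarrow> real^'d \<Rightarrow> real^'d" where
  "gradient F x = (THE g. GDERIV F x :> g)"

text \<open>\<open>w\<close> and \<open>u\<close> are the iterates, indexed from 1, of the accelerated Shotgun algorithm on \<open>F\<close> with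
  step size coefficient \<open>\<eta>\<close>, smoothness parameter \<open>\<beta>\<close> and constants \<open>\<gamma>\<close>, \<open>c\<close>, when coordinate set
  \<open>S t\<close> is picked in iteration \<open>t\<close>. The values at index 0 are irrelevant. The sets are arbitrary
  here; their law, including their cardinality, is imposed by \<open>uniform_coordinate_sets\<close>.\<close>

definition accelerated_shotgun ::
  "(real^'d \<Rightarrow> real) \<Rightarrow> real \<Rightarrow> real \<Rightarrow> (nat \<Rightarrow> real) \<Rightarrow> (nat \<Rightarrow> real) \<Rightarrow> (nat \<Rightarrow> 'd set)
    \<Rightarrow> (nat \<Rightarrow> real^'d) \<Rightarrow> (nat \<Rightarrow> real^'d) \<Rightarrow> bool" where
  "accelerated_shotgun F \<eta> \<beta> \<gamma> c S w u \<longleftrightarrow>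
     w 1 = u 1 \<and>
     (\<forall>t\<ge>1.
        w (t + 1) = (\<chi> j. if j \<in> S t then u t $ j - \<eta> / \<beta> * gradient F (u t) $ j else u t $ j) \<and>
        u (t + 1) = (1 - \<gamma> t) *\<^sub>R w (t + 1) + \<gamma> t *\<^sub>R w t + c t *\<^sub>R (u t - w (t + 1)))"

definition uniform_coordinate_sets ::
  "'a measure \<Rightarrow> nat \<Rightarrow> (nat \<Rightarrow> 'a \<Rightarrow> 'd::finite set) \<Rightarrow> bool" where
  "uniform_coordinate_sets M P S \<longleftrightarrow>
     prob_space.indep_vars M (\<lambda>_. count_space UNIV) S {1..} \<and>
     (\<forall>t\<ge>1. distr M (count_space UNIV) (S t) = measure_pmf (pmf_of_set {A. card A = P}))"

primrec theta :: "nat \<Rightarrow> real" where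
  "theta 0 = 0"
| "theta (Suc t) = (1 + sqrt (1 + 4 * (theta t)\<^sup>2)) / 2"

end

theory Submission
  imports Defs
begin

text \<open>
  Write \<open>\<sigma>\<close> as in the statement and put \<open>\<kappa> = 1 - \<eta>/2 (1 + \<sigma>)\<close>, \<open>p = P/d\<close>, \<open>a = 2 p \<kappa> \<eta> / \<beta>\<close>.
  Smoothness and the first two moments of a uniform \<open>P\<close>-subset give the expected one-step decrease
  \<open>E F(w\<^sub>t\<^sub>+\<^sub>1) \<le> F(u\<^sub>t) - a/2 \<parallel>\<nabla>F(u\<^sub>t)\<parallel>\<^sup>2\<close>; the cross terms are a quadratic form in \<open>X\<^sup>T X\<close>, bounded by
  its spectral radius. The constants \<open>\<gamma>\<^sub>t\<close>, \<open>c\<^sub>t\<close> are such that \<open>z\<^sub>t = \<theta>\<^sub>t u\<^sub>t - (\<theta>\<^sub>t - 1) w\<^sub>t\<close> moves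
  by exactly \<open>- \<theta>\<^sub>t a\<close> times the sampled part of the gradient. By convexity and \<open>\<theta>\<^sub>t (\<theta>\<^sub>t - 1) = \<theta>\<^sub>t\<^sub>-\<^sub>1\<^sup>2\<close>
  the potential \<open>2 a p \<theta>\<^sub>t\<^sub>-\<^sub>1\<^sup>2 (F(w\<^sub>t) - F(w\<^sup>*)) + \<parallel>z\<^sub>t - w\<^sup>*\<parallel>\<^sup>2\<close> then decreases in expectation, and
  \<open>\<theta>\<^sub>t\<^sub>-\<^sub>1 \<ge> t/2\<close>.
\<close>

section \<open>Spectral radius of a symmetric matrix\<close>

text \<open>A real \<open>SUP\<close> dominates its elements only when they are bounded above. Here
  any operator norm bound of the complexified matrix serves, since it can be tested on
  eigenvectors.\<close>

lemma bdd_above_cmod_eigenvalues: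
  fixes A :: "real^'d^'d"
  shows "bdd_above (cmod ` eigenvalues A)"
proof -
  let ?f = "\<lambda>v :: complex^'d. map_matrix complex_of_real A *v v"
  have "linear ?f"
    by (intro linearI) (auto simp: matrix_vector_mult_def vec_eq_iff algebra_simps sum.distrib
        scaleR_sum_right)
  then obtain B where B: "\<And>v. norm (?f v) \<le> B * norm v"
    using linear_bounded by blast
  have "cmod k \<le> B" if k: "k \<in> eigenvalues A" for k
  proof -
    obtain v :: "complex^'d" where v: "v \<noteq> 0" "?f v = k *s v"
      using k by (auto simp: eigenvalues_def)
    have "norm (k *s v) = cmod k * norm v"
      by (simp add: norm_vec_def L2_set_right_distrib norm_mult)
    with B[of v] v show ?thesis by simp
  qed
  then show ?thesis by (auto simp: bdd_above_def)
qed

text \<open>\<open>eigenvalues\<close> lives over the complex numbers, so the real eigenvector is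
  first embedded coordinatewise.\<close>

lemma real_eigenvalue_le_spectral_radius:
  fixes A :: "real^'d^'d"
  assumes "v \<noteq> 0" and "A *v v = l *\<^sub>R v"
  shows "l \<le> spectral_radius A"
proof -
  let ?v = "(\<chi> i. complex_of_real (v $ i)) :: complex^'d"
  have "?v \<noteq> 0"
    using assms(1) by (auto simp: vec_eq_iff)
  moreover have "map_matrix complex_of_real A *v ?v = complex_of_real l *s ?v"
  proof -
    have "(\<Sum>j\<in>UNIV. A $ i $ j * v $ j) = l * v $ i" for i
      using assms(2) by (simp add: matrix_vector_mult_def vec_eq_iff)
    then have "(\<Sum>j\<in>UNIV. complex_of_real (A $ i $ j) * complex_of_real (v $ j))
        = complex_of_real l * complex_of_real (v $ i)" for i
      by (metis (mono_tags, lifting) of_real_mult of_real_sum sum.cong)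
    then show ?thesis
      by (simp add: matrix_vector_mult_def vec_eq_iff map_matrix_def)
  qed
  ultimately have "complex_of_real l \<in> eigenvalues A"
    by (auto simp: eigenvalues_def)
  then have "cmod (complex_of_real l) \<le> spectral_radius A"
    unfolding spectral_radius_def by (rule cSUP_upper[OF _ bdd_above_cmod_eigenvalues])
  then show ?thesis by simp
qed

text \<open>Along the line \<open>v + s *\<^sub>R f v\<close> the quadratic form equals
  \<open>2 * s * b + s\<^sup>2 * q\<close> with \<open>b\<close> the squared norm of
  \<open>f v\<close>. If \<open>b > 0\<close>, the linear term makes it negative for small negative
  \<open>s\<close>.\<close>

lemma psd_inner_zero_imp_kernel:
  fixes f :: "'v::real_inner \<Rightarrow> 'v"
  assumes f: "linear f" and sym: "\<And>x y. f x \<bullet> y = x \<bullet> f y"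
    and psd: "\<And>x. x \<bullet> f x \<ge> 0" and v: "v \<bullet> f v = 0"
  shows "f v = 0"
proof (rule ccontr)
  assume nz: "f v \<noteq> 0"
  define b where "b = f v \<bullet> f v"
  define q where "q = f v \<bullet> f (f v)"
  have b: "b > 0" using nz by (simp add: b_def)
  have q: "q \<ge> 0" using psd by (simp add: q_def)
  have 1: "2 * s * b + s\<^sup>2 * q \<ge> 0" for s
  proof -
    have "(v + s *\<^sub>R f v) \<bullet> f (v + s *\<^sub>R f v) = 2 * s * b + s\<^sup>2 * q"
      using v sym[of v "f v"] by (simp add: linear_add[OF f] linear_scale[OF f] inner_add_left inner_add_right
          b_def q_def power2_eq_square algebra_simps)
    then show ?thesis using psd[of "v + s *\<^sub>R f v"] by simp
  qed
  \<comment> \<open>The minimizer of the quadratic is \<open>- b / q\<close>; the denominator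
    \<open>q + 1\<close> also covers \<open>q = 0\<close>.\<close>
  have "2 * (- (b / (q + 1))) * b + (- (b / (q + 1)))\<^sup>2 * q
      = b\<^sup>2 / (q + 1) * (q / (q + 1) - 2)"
    by (simp add: power2_eq_square algebra_simps)
  also have "\<dots> < 0"
    using b q by (intro mult_pos_neg) (auto simp: field_simps)
  finally show False using 1[of "- (b / (q + 1))"] by simp
qed

text \<open>Rayleigh quotient argument: by compactness the form attains a maximum \<open>l\<close>
  on the unit sphere, at some \<open>v\<close>. Then \<open>l *\<^sub>R x - A *v x\<close> defines a
  positive semidefinite form vanishing at \<open>v\<close>, so \<open>v\<close> lies in its kernel
  and is an eigenvector for \<open>l\<close>.\<close>

lemma inner_matrix_le_spectral_radius:
  fixes A :: "real^'d^'d"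
  assumes "transpose A = A"
  shows "x \<bullet> (A *v x) \<le> spectral_radius A * (norm x)\<^sup>2"
proof -
  have "continuous_on (sphere 0 1) (\<lambda>x. x \<bullet> (A *v x))"
    by (intro continuous_intros linear_continuous_on matrix_vector_mul_bounded_linear)
  moreover have "(sphere 0 1 :: (real^'d) set) \<noteq> {}"
    by (simp add: sphere_eq_empty)
  ultimately obtain v :: "real^'d" where v: "norm v = 1"
      and max: "\<And>y. norm y = 1 \<Longrightarrow> y \<bullet> (A *v y) \<le> v \<bullet> (A *v v)"
    using continuous_attains_sup[of "sphere 0 1 :: (real^'d) set" "\<lambda>x. x \<bullet> (A *v x)"] by auto
  define l where "l = v \<bullet> (A *v v)"
  have le: "x \<bullet> (A *v x) \<le> l * (norm x)\<^sup>2" for x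
  proof (cases "x = 0")
    case False
    have "(x /\<^sub>R norm x) \<bullet> (A *v (x /\<^sub>R norm x)) \<le> l"
      unfolding l_def using False by (intro max) simp
    then show ?thesis using False
      by (simp add: matrix_vector_mult_scaleR power2_eq_square field_simps)
  qed simp
  have sym: "(A *v x) \<bullet> y = x \<bullet> (A *v y)" for x y
    by (metis assms dot_lmul_matrix vector_transpose_matrix)
  let ?f = "\<lambda>x. l *\<^sub>R x - A *v x"
  have "?f v = 0"
  proof (rule psd_inner_zero_imp_kernel[where f = ?f])
    show "linear ?f"
      by (intro linear_compose_sub linear_compose_scale_right matrix_vector_mul_linear linear_ident)
    show "?f x \<bullet> y = x \<bullet> ?f y" for x y
      using sym by (simp add: inner_diff_left inner_diff_right)
    show "x \<bullet> ?f x \<ge> 0" for x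
      using le[of x] by (simp add: inner_diff_right power2_norm_eq_inner)
    show "v \<bullet> ?f v = 0"
      using v by (simp add: inner_diff_right power2_norm_eq_inner[symmetric] l_def)
  qed
  then have "l \<le> spectral_radius A"
    using v by (intro real_eigenvalue_le_spectral_radius[of v]) auto
  then show ?thesis
    using le[of x] by (meson mult_right_mono order_trans zero_le_power2)
qed

section \<open>Moments of uniform subsets\<close>

text \<open>Removing \<open>T\<close> is a bijection onto the subsets of its complement of size
  \<open>k - card T\<close>. The case of empty \<open>T\<close> counts all \<open>k\<close>-subsets;
  singletons and pairs give the first and second moments.\<close>

lemma card_supersets_of_card:
  fixes T :: "'d::finite set"
  assumes "card T \<le> k"
  shows "card {A. T \<subseteq> A \<and> card A = k} = (CARD('d) - card T) choose (k - card T)"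
proof -
  have "bij_betw (\<lambda>B. B \<union> T) {B. B \<subseteq> - T \<and> card B = k - card T} {A. T \<subseteq> A \<and> card A = k}"
  proof (rule bij_betw_byWitness[where f' = "\<lambda>A. A - T"])
    show "(\<lambda>B. B \<union> T) ` {B. B \<subseteq> - T \<and> card B = k - card T} \<subseteq> {A. T \<subseteq> A \<and> card A = k}"
      using assms by (auto intro!: card_Un_disjoint[THEN trans])
    show "(\<lambda>A. A - T) ` {A. T \<subseteq> A \<and> card A = k} \<subseteq> {B. B \<subseteq> - T \<and> card B = k - card T}"
      by (auto simp: card_Diff_subset)
  qed auto
  then have "card {A. T \<subseteq> A \<and> card A = k} = card {B. B \<subseteq> - T \<and> card B = k - card T}"
    by (rule bij_betw_same_card[symmetric])
  also have "\<dots> = card (- T) choose (k - card T)"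
    by (rule n_subsets) simp
  finally show ?thesis
    using card_Diff_subset[of T UNIV] by (simp add: Compl_eq_Diff_UNIV)
qed

abbreviation subset_mean :: "nat \<Rightarrow> ('d::finite set \<Rightarrow> real) \<Rightarrow> real" where
  "subset_mean k f \<equiv> measure_pmf.expectation (pmf_of_set {A. card A = k}) f"

lemma nonempty_subsets_of_card:
  assumes "k \<le> CARD('d::finite)"
  shows "{A :: 'd set. card A = k} \<noteq> {}"
  using obtain_subset_with_card_n[OF assms] by blast

lemma subset_mean_eq:
  fixes f :: "'d::finite set \<Rightarrow> real"
  assumes "k \<le> CARD('d)"
  shows "subset_mean k f = (\<Sum>A | card A = k. f A) / real (CARD('d) choose k)"
  using card_supersets_of_card[of "{} :: 'd set" k] nonempty_subsets_of_card[OF assms]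
  by (simp add: integral_pmf_of_set)

lemma subset_mean_supersets:
  fixes T :: "'d::finite set"
  assumes "card T \<le> k" and "k \<le> CARD('d)"
  shows "subset_mean k (\<lambda>A. of_bool (T \<subseteq> A))
      = real ((CARD('d) - card T) choose (k - card T)) / real (CARD('d) choose k)"
proof -
  have "(\<Sum>A | card A = k. of_bool (T \<subseteq> A) :: real) = real (card {A. T \<subseteq> A \<and> card A = k})"
    by (simp add: sum.If_cases Collect_conj_eq Int_commute)
  then show ?thesis
    using assms by (simp add: subset_mean_eq card_supersets_of_card)
qed

lemma subset_mean_mem:
  fixes j :: "'d::finite"
  assumes "1 \<le> k" and "k \<le> CARD('d)"
  shows "subset_mean k (\<lambda>A. of_bool (j \<in> A)) = real k / real CARD('d)"
proof -
  have "k * (CARD('d) choose k) = CARD('d) * ((CARD('d) - 1) choose (k - 1))"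
    using assms times_binomial_minus1_eq[of k "CARD('d)"] by simp
  then have "real k * real (CARD('d) choose k) = real CARD('d) * real ((CARD('d) - 1) choose (k - 1))"
    by (metis of_nat_mult)
  then have "real ((CARD('d) - 1) choose (k - 1)) / real (CARD('d) choose k) = real k / real CARD('d)"
    using assms by (subst frac_eq_eq) (auto simp: mult.commute)
  then show ?thesis
    using assms subset_mean_supersets[of "{j}" k] by simp
qed

lemma subset_mean_mem_mem:
  fixes i j :: "'d::finite"
  assumes "1 \<le> k" and "k \<le> CARD('d)" and "i \<noteq> j"
  shows "subset_mean k (\<lambda>A. of_bool (i \<in> A \<and> j \<in> A))
      = real k / real CARD('d) * ((real k - 1) / (real CARD('d) - 1))"
\<comment> \<open>A one-element set contains no pair, so both sides vanish. The counting lemma asks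
  for \<open>card T \<le> k\<close> and thus covers only \<open>k \<ge> 2\<close>.\<close>
proof (cases "k = 1")
  case True
  have "\<not> (i \<in> A \<and> j \<in> A)" if "card A = k" for A
    using that assms(3) True by (auto simp: card_1_singleton_iff)
  then have "(\<Sum>A | card A = k. of_bool (i \<in> A \<and> j \<in> A) :: real) = 0"
    by (intro sum.neutral) auto
  then show ?thesis
    using True assms by (simp add: subset_mean_eq)
next
  case False
  define d where "d = CARD('d)"
  have k: "2 \<le> k" "k \<le> d" using False assms by (auto simp: d_def)
  have 1: "k * (d choose k) = d * ((d - 1) choose (k - 1))"
    using k times_binomial_minus1_eq[of k d] by simp
  have 2: "(k - 1) * ((d - 1) choose (k - 1)) = (d - 1) * ((d - 2) choose (k - 2))"
    using k times_binomial_minus1_eq[of "k - 1" "d - 1"] by (simp add: numeral_2_eq_2)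
  have "(k * (k - 1)) * (d choose k) = (d * (d - 1)) * ((d - 2) choose (k - 2))"
    using 1 2 by (metis (no_types, lifting) mult.assoc mult.commute)
  then have "real k * (real k - 1) * real (d choose k)
      = real d * (real d - 1) * real ((d - 2) choose (k - 2))"
    using k by (metis (mono_tags, lifting) of_nat_mult of_nat_diff of_nat_1 le_trans one_le_numeral)
  then have "real ((d - 2) choose (k - 2)) / real (d choose k)
      = (real k * (real k - 1)) / (real d * (real d - 1))"
    using k by (subst frac_eq_eq) (auto simp: mult.commute)
  then show ?thesis
    using k assms subset_mean_supersets[of "{i, j}" k] unfolding d_def[symmetric]
    by (simp add: numeral_2_eq_2)
qed

lemma integrable_subset_mean [simp]:
  "integrable (measure_pmf (pmf_of_set {A :: 'd::finite set. card A = k})) (f :: 'd set \<Rightarrow> real)"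
  by (rule integrable_measure_pmf_finite) simp

text \<open>With \<open>g\<close> the gradient at \<open>u\<close>, an iteration reads
  \<open>u - (\<eta> / \<beta>) *\<^sub>R mask_coords S g\<close>, where the randomness enters only
  through the mask.\<close>

definition mask_coords :: "'d set \<Rightarrow> real^'d \<Rightarrow> real^'d" where
  "mask_coords A g = (\<chi> j. if j \<in> A then g $ j else 0)"

lemma subset_mean_inner_mask:
  fixes x g :: "real^'d"
  assumes "1 \<le> k" and "k \<le> CARD('d)"
  shows "subset_mean k (\<lambda>A. x \<bullet> mask_coords A g) = real k / real CARD('d) * (x \<bullet> g)"
proof -
  have "x \<bullet> mask_coords A g = (\<Sum>j\<in>UNIV. x $ j * g $ j * of_bool (j \<in> A))" for A
    unfolding inner_vec_def by (rule sum.cong) (auto simp: mask_coords_def)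
  then have "subset_mean k (\<lambda>A. x \<bullet> mask_coords A g)
      = subset_mean k (\<lambda>A. \<Sum>j\<in>UNIV. x $ j * g $ j * of_bool (j \<in> A))"
    by simp
  also have "\<dots> = (\<Sum>j\<in>UNIV. x $ j * g $ j * (real k / real CARD('d)))"
    using assms by (simp add: subset_mean_mem del: sum_mult_of_bool_eq)
  also have "\<dots> = real k / real CARD('d) * (x \<bullet> g)"
    by (simp add: inner_vec_def sum_divide_distrib sum_distrib_left mult.commute)
  finally show ?thesis .
qed

text \<open>Masking is an orthogonal projection, so the squared norm is the inner product with
  \<open>g\<close> itself and is linear in the inclusion indicators.\<close>

lemma subset_mean_norm_mask:
  fixes g :: "real^'d"
  assumes "1 \<le> k" and "k \<le> CARD('d)"
  shows "subset_mean k (\<lambda>A. (norm (mask_coords A g))\<^sup>2) = real k / real CARD('d) * (norm g)\<^sup>2"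
proof -
  have "(norm (mask_coords A g))\<^sup>2 = g \<bullet> mask_coords A g" for A
    unfolding power2_norm_eq_inner by (auto simp: mask_coords_def inner_vec_def intro!: sum.cong)
  then show ?thesis
    using subset_mean_inner_mask[OF assms, of g g] by (simp add: power2_norm_eq_inner)
qed

text \<open>Two indices are sampled together with probability \<open>p\<close> if they coincide and
  \<open>p * r\<close> otherwise, where \<open>p\<close> is the sampled fraction. So the mean form
  is \<open>p * r\<close> times the full form plus \<open>p * (1 - r)\<close> times its diagonal
  part, which for a unit diagonal is the squared norm.\<close>

lemma subset_mean_quadratic_form_mask:
  fixes A :: "real^'d^'d" and g :: "real^'d"
  assumes "1 \<le> k" and "k \<le> CARD('d)" and diag: "\<And>i. A $ i $ i = 1"
  defines "r \<equiv> (real k - 1) / (real CARD('d) - 1)"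
  shows "subset_mean k (\<lambda>S. mask_coords S g \<bullet> (A *v mask_coords S g))
      = real k / real CARD('d) * ((1 - r) * (norm g)\<^sup>2 + r * (g \<bullet> (A *v g)))"
proof -
  define p where "p = real k / real CARD('d)"
  have pair: "subset_mean k (\<lambda>S. of_bool (i \<in> S \<and> j \<in> S)) = p * (r + (1 - r) * of_bool (i = j))"
    for i j :: 'd
    using subset_mean_mem[of k i] subset_mean_mem_mem[of k i j] assms by (cases "i = j") (auto simp: p_def)
  have form: "x \<bullet> (A *v x) = (\<Sum>i\<in>UNIV. \<Sum>j\<in>UNIV. A $ i $ j * x $ i * x $ j)" for x
    by (simp add: inner_vec_def matrix_vector_mult_def sum_distrib_left mult_ac)
  have "mask_coords S g \<bullet> (A *v mask_coords S g)
      = (\<Sum>i\<in>UNIV. \<Sum>j\<in>UNIV. A $ i $ j * g $ i * g $ j * of_bool (i \<in> S \<and> j \<in> S))" for S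
    unfolding form by (intro sum.cong) (auto simp: mask_coords_def)
  then have "subset_mean k (\<lambda>S. mask_coords S g \<bullet> (A *v mask_coords S g))
      = subset_mean k (\<lambda>S. \<Sum>i\<in>UNIV. \<Sum>j\<in>UNIV. A $ i $ j * g $ i * g $ j * of_bool (i \<in> S \<and> j \<in> S))"
    by simp
  also have "\<dots> = (\<Sum>i\<in>UNIV. \<Sum>j\<in>UNIV. A $ i $ j * g $ i * g $ j *
      subset_mean k (\<lambda>S. of_bool (i \<in> S \<and> j \<in> S)))"
    by (simp del: sum_mult_of_bool_eq)
  also have "\<dots> = (\<Sum>i\<in>UNIV. \<Sum>j\<in>UNIV. p * r * (A $ i $ j * g $ i * g $ j)
      + (if i = j then p * (1 - r) * (A $ i $ i * g $ i * g $ i) else 0))"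
    unfolding pair by (intro sum.cong) (auto simp: algebra_simps)
  also have "\<dots> = p * r * (g \<bullet> (A *v g)) + p * (1 - r) * (norm g)\<^sup>2"
    unfolding form power2_norm_eq_inner
    by (simp add: sum.distrib sum_distrib_left diag inner_vec_def)
  finally show ?thesis
    by (simp add: p_def algebra_simps add_divide_distrib diff_divide_distrib)
qed

lemma subset_mean_quadratic_form_mask_le:
  fixes A :: "real^'d^'d" and g :: "real^'d"
  assumes "1 \<le> k" and "k \<le> CARD('d)" and "\<And>i. A $ i $ i = 1" and "transpose A = A"
  shows "subset_mean k (\<lambda>S. mask_coords S g \<bullet> (A *v mask_coords S g))
      \<le> real k / real CARD('d) *
        (1 + (real k - 1) * (spectral_radius A - 1) / (real CARD('d) - 1)) * (norm g)\<^sup>2"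
proof -
  define r where "r = (real k - 1) / (real CARD('d) - 1)"
  have "r \<ge> 0"
    using assms by (simp add: r_def)
  then have "r * (g \<bullet> (A *v g)) \<le> r * (spectral_radius A * (norm g)\<^sup>2)"
    by (intro mult_left_mono inner_matrix_le_spectral_radius assms)
  then have "real k / real CARD('d) * ((1 - r) * (norm g)\<^sup>2 + r * (g \<bullet> (A *v g)))
      \<le> real k / real CARD('d) * ((1 - r) * (norm g)\<^sup>2 + r * (spectral_radius A * (norm g)\<^sup>2))"
    by (rule mult_left_mono[OF add_left_mono]) simp
  also have "\<dots> = real k / real CARD('d) * (1 + r * (spectral_radius A - 1)) * (norm g)\<^sup>2"
    by (simp add: algebra_simps add_divide_distrib)
  finally show ?thesis
    using assms by (simp add: subset_mean_quadratic_form_mask r_def)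
qed

section \<open>Sums of ridge functions\<close>

text \<open>The function \<open>\<beta> / 2 * x\<^sup>2 - f x\<close> has nonnegative second
  derivative, hence is convex; its tangent inequality rearranges to the claim.\<close>

lemma bounded_second_deriv_imp_quadratic_upper_bound:
  fixes f :: "real \<Rightarrow> real"
  assumes "\<And>x. f differentiable (at x)" and "\<And>x. deriv f differentiable (at x)"
    and "\<And>x. deriv (deriv f) x \<le> \<beta>"
  shows "f b \<le> f a + deriv f a * (b - a) + \<beta> / 2 * (b - a)\<^sup>2"
proof -
  have D: "(f has_real_derivative deriv f x) (at x)"
    "(deriv f has_real_derivative deriv (deriv f) x) (at x)" for x
    using assms(1,2) by (simp_all add: DERIV_deriv_iff_real_differentiable)
  define h where "h = (\<lambda>x. \<beta> / 2 * x\<^sup>2 - f x)"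
  have h: "(h has_real_derivative \<beta> * x - deriv f x) (at x)" for x
    unfolding h_def by (auto intro!: derivative_eq_intros D)
  have "convex_on UNIV h"
  proof (rule f''_ge0_imp_convex[OF _ h])
    show "((\<lambda>x. \<beta> * x - deriv f x) has_real_derivative \<beta> - deriv (deriv f) x) (at x)" for x
      by (auto intro!: derivative_eq_intros D)
  qed (use assms(3) in auto)
  from convex_on_imp_above_tangent[OF this connected_UNIV _ UNIV_I h, of a b]
  show ?thesis
    by (simp add: h_def power2_eq_square field_simps)
qed

lemma gradient_eqI:
  assumes "GDERIV F x :> g"
  shows "gradient F x = g"
  unfolding gradient_def
proof (rule the_equality[where P = "\<lambda>g. GDERIV F x :> g", OF assms])
  fix g' assume "GDERIV F x :> g'"
  then have "(\<lambda>h. h \<bullet> g') = (\<lambda>h. h \<bullet> g)"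
    using assms unfolding gderiv_def by (rule has_derivative_unique)
  then show "g' = g"
    by (metis inner_commute vector_eq_ldot)
qed

lemma gderiv_sum:
  assumes "\<And>i. i \<in> I \<Longrightarrow> GDERIV (f i) x :> g i"
  shows "GDERIV (\<lambda>x. \<Sum>i\<in>I. f i x) x :> (\<Sum>i\<in>I. g i)"
  using assms unfolding gderiv_def inner_sum_right by (rule has_derivative_sum)

lemma gradient_sum_ridge:
  fixes X :: "real^'d^'n" and f :: "'n \<Rightarrow> real \<Rightarrow> real"
  assumes "\<And>i a. f i differentiable (at a)"
  shows "gradient (\<lambda>v. \<Sum>i\<in>UNIV. f i (row i X \<bullet> v)) v
      = (\<Sum>i\<in>UNIV. deriv (f i) (row i X \<bullet> v) *\<^sub>R row i X)"
proof (intro gradient_eqI gderiv_sum)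
  fix i
  have "GDERIV (\<lambda>v. row i X \<bullet> v) v :> row i X"
    unfolding gderiv_def by (auto intro!: derivative_eq_intros simp: inner_commute)
  moreover have "(f i has_real_derivative deriv (f i) (row i X \<bullet> v)) (at (row i X \<bullet> v))"
    using assms by (simp add: DERIV_deriv_iff_real_differentiable)
  ultimately show "GDERIV (\<lambda>v. f i (row i X \<bullet> v)) v :> deriv (f i) (row i X \<bullet> v) *\<^sub>R row i X"
    by (rule GDERIV_DERIV_compose)
qed

lemma convex_sum_ridge_above_tangent:
  fixes X :: "real^'d^'n" and f :: "'n \<Rightarrow> real \<Rightarrow> real"
  assumes d: "\<And>i a. f i differentiable (at a)" and c: "\<And>i. convex_on UNIV (f i)"
  defines "F \<equiv> \<lambda>v. \<Sum>i\<in>UNIV. f i (row i X \<bullet> v)"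
  shows "F a + gradient F a \<bullet> (b - a) \<le> F b"
proof -
  have "f i (row i X \<bullet> a) + deriv (f i) (row i X \<bullet> a) * (row i X \<bullet> (b - a)) \<le> f i (row i X \<bullet> b)" for i
    using convex_on_imp_above_tangent[OF c[of i] connected_UNIV _ UNIV_I,
        where c = "row i X \<bullet> a" and f' = "deriv (f i) (row i X \<bullet> a)" and x = "row i X \<bullet> b"] d[of i]
    by (simp add: DERIV_deriv_iff_real_differentiable inner_diff_right)
  then have "(\<Sum>i\<in>UNIV. f i (row i X \<bullet> a) + deriv (f i) (row i X \<bullet> a) * (row i X \<bullet> (b - a))) \<le> F b"
    unfolding F_def by (rule sum_mono)
  then show ?thesis
    unfolding F_def gradient_sum_ridge[of f, OF d] by (simp add: inner_sum_left sum.distrib)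
qed

text \<open>The quadratic term is kept as a form in \<open>transpose X ** X\<close> instead of being
  bounded by a multiple of the squared norm of \<open>h\<close>: averaging over the sampled set
  later exploits the unit diagonal of this matrix.\<close>

lemma sum_ridge_quadratic_upper_bound:
  fixes X :: "real^'d^'n" and f :: "'n \<Rightarrow> real \<Rightarrow> real"
  assumes d: "\<And>i a. f i differentiable (at a)" and "\<And>i a. deriv (f i) differentiable (at a)"
    and "\<And>i a. deriv (deriv (f i)) a \<le> \<beta>"
  defines "F \<equiv> \<lambda>v. \<Sum>i\<in>UNIV. f i (row i X \<bullet> v)"
  shows "F (a + h) \<le> F a + gradient F a \<bullet> h + \<beta> / 2 * (h \<bullet> ((transpose X ** X) *v h))"
proof -
  have "f i (row i X \<bullet> (a + h)) \<le> f i (row i X \<bullet> a) + deriv (f i) (row i X \<bullet> a) * (row i X \<bullet> h)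
      + \<beta> / 2 * (row i X \<bullet> h)\<^sup>2" for i
    using bounded_second_deriv_imp_quadratic_upper_bound[of "f i" \<beta> "row i X \<bullet> (a + h)" "row i X \<bullet> a"]
      assms(1-3) by (simp add: inner_add_right)
  then have "F (a + h) \<le> (\<Sum>i\<in>UNIV. f i (row i X \<bullet> a) + deriv (f i) (row i X \<bullet> a) * (row i X \<bullet> h)
      + \<beta> / 2 * (row i X \<bullet> h)\<^sup>2)"
    unfolding F_def by (rule sum_mono)
  also have "\<dots> = F a + gradient F a \<bullet> h + \<beta> / 2 * (\<Sum>i\<in>UNIV. (row i X \<bullet> h)\<^sup>2)"
    unfolding F_def gradient_sum_ridge[of f, OF d]
    by (simp add: inner_sum_left sum.distrib sum_distrib_left)
  also have "(\<Sum>i\<in>UNIV. (row i X \<bullet> h)\<^sup>2) = (X *v h) \<bullet> (X *v h)"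
    by (simp add: inner_vec_def matrix_vector_mult_def row_def power2_eq_square)
  also have "\<dots> = h \<bullet> ((transpose X ** X) *v h)"
    by (metis dot_lmul_matrix inner_commute matrix_vector_mul_assoc vector_transpose_matrix)
  finally show ?thesis .
qed

section \<open>One step of the algorithm\<close>

text \<open>\<open>theta (Suc t)\<close> is a root of
  \<open>x\<^sup>2 - x = (theta t)\<^sup>2\<close>. This makes the potential telescope: the weight a
  step leaves on the old function value is the weight already present.\<close>

lemma theta_Suc_recurrence: "theta (Suc t) * (theta (Suc t) - 1) = (theta t)\<^sup>2"
proof -
  have "(sqrt (1 + 4 * (theta t)\<^sup>2))\<^sup>2 = 1 + 4 * (theta t)\<^sup>2"
    by (simp add: add_nonneg_nonneg)
  then show ?thesis
    by (simp add: power2_eq_square field_simps)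
qed

text \<open>Dropping the 1 under the root shows that each step adds at least 1/2, starting from
  \<open>theta 1 = 1\<close>.\<close>

lemma theta_Suc_ge: "theta (Suc t) \<ge> (real t + 2) / 2"
proof (induction t)
  case (Suc t)
  have "2 * theta (Suc t) \<le> sqrt (1 + 4 * (theta (Suc t))\<^sup>2)"
    by (rule real_le_rsqrt) (simp add: power_mult_distrib del: theta.simps)
  then show ?case
    using Suc by (subst theta.simps(2)) (simp del: theta.simps)
qed simp

text \<open>Smoothness is applied to the masked step and averaged. The linear term gains
  \<open>\<eta> / \<beta> * p\<close> times the squared gradient norm; the quadratic term loses at
  most the fraction \<open>\<eta> / 2 * (1 + \<sigma>)\<close> of that gain.\<close>

lemma subset_mean_coordinate_step_le:
  fixes A :: "real^'d^'d" and g u :: "real^'d"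
  assumes k: "1 \<le> k" "k \<le> CARD('d)" and A: "\<And>i. A $ i $ i = 1" "transpose A = A"
    and "\<beta> > 0"
    and smooth: "\<And>h. F (u + h) \<le> F u + g \<bullet> h + \<beta> / 2 * (h \<bullet> (A *v h))"
  defines "\<sigma> \<equiv> (real k - 1) * (spectral_radius A - 1) / (real CARD('d) - 1)"
  shows "subset_mean k (\<lambda>S. F (u - (\<eta> / \<beta>) *\<^sub>R mask_coords S g))
      \<le> F u - real k / real CARD('d) * \<eta> / \<beta> * (1 - \<eta> / 2 * (1 + \<sigma>)) * (norm g)\<^sup>2"
proof -
  define p where "p = real k / real CARD('d)"
  let ?m = "\<lambda>S. mask_coords S g"
  have "F (u - (\<eta> / \<beta>) *\<^sub>R ?m S)
      \<le> F u - \<eta> / \<beta> * (g \<bullet> ?m S) + \<eta>\<^sup>2 / (2 * \<beta>) * (?m S \<bullet> (A *v ?m S))" for S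
    using smooth[of "- (\<eta> / \<beta>) *\<^sub>R ?m S"] \<open>\<beta> > 0\<close>
    by (simp add: matrix_vector_mult_scaleR linear_neg[OF matrix_vector_mul_linear]
        power2_eq_square)
  then have "subset_mean k (\<lambda>S. F (u - (\<eta> / \<beta>) *\<^sub>R ?m S))
      \<le> subset_mean k (\<lambda>S. F u - \<eta> / \<beta> * (g \<bullet> ?m S) + \<eta>\<^sup>2 / (2 * \<beta>) * (?m S \<bullet> (A *v ?m S)))"
    by (intro integral_mono) auto
  also have "\<dots> = F u - \<eta> / \<beta> * (p * (norm g)\<^sup>2)
      + \<eta>\<^sup>2 / (2 * \<beta>) * subset_mean k (\<lambda>S. ?m S \<bullet> (A *v ?m S))"
    using k by (simp add: subset_mean_inner_mask power2_norm_eq_inner p_def)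
  also have "\<dots> \<le> F u - \<eta> / \<beta> * (p * (norm g)\<^sup>2) + \<eta>\<^sup>2 / (2 * \<beta>) * (p * (1 + \<sigma>) * (norm g)\<^sup>2)"
    using subset_mean_quadratic_form_mask_le[OF k A, of g] \<open>\<beta> > 0\<close> unfolding p_def \<sigma>_def
    by (intro add_left_mono mult_left_mono) auto
  also have "\<dots> = F u - p * \<eta> / \<beta> * (1 - \<eta> / 2 * (1 + \<sigma>)) * (norm g)\<^sup>2"
    using \<open>\<beta> > 0\<close> by (simp add: field_simps power2_eq_square)
  finally show ?thesis
    by (simp add: p_def)
qed

text \<open>The weight \<open>2 * a * p\<close> balances the two parts of the potential: the
  decrease of \<open>F\<close> pays exactly for the squared gradient norm from moving
  \<open>z\<close>. The remaining cross term \<open>(z - x) \<bullet> g\<close> is handled by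
  convexity.\<close>

lemma subset_mean_potential_step_le:
  fixes F :: "real^'d \<Rightarrow> real" and g u w x :: "real^'d"
  assumes k: "1 \<le> k" "k \<le> CARD('d)"
    and tangent: "\<And>b. F u + g \<bullet> (b - u) \<le> F b"
    and descent: "subset_mean k (\<lambda>S. F (u - s *\<^sub>R mask_coords S g)) \<le> F u - a / 2 * (norm g)\<^sup>2"
    and "a \<ge> 0" and "\<theta> \<ge> 1"
  defines "p \<equiv> real k / real CARD('d)" and "z \<equiv> \<theta> *\<^sub>R u - (\<theta> - 1) *\<^sub>R w"
  shows "subset_mean k (\<lambda>S. 2 * a * p * \<theta>\<^sup>2 * (F (u - s *\<^sub>R mask_coords S g) - F x)
        + (norm (z - (\<theta> * a) *\<^sub>R mask_coords S g - x))\<^sup>2)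
      \<le> 2 * a * p * (\<theta> * (\<theta> - 1)) * (F w - F x) + (norm (z - x))\<^sup>2"
proof -
  let ?m = "\<lambda>S. mask_coords S g"
  define f where "f = subset_mean k (\<lambda>S. F (u - s *\<^sub>R ?m S))"
  have p: "p \<ge> 0" by (simp add: p_def)
  have norm_step: "(norm (z - (\<theta> * a) *\<^sub>R ?m S - x))\<^sup>2
      = (norm (z - x))\<^sup>2 - 2 * \<theta> * a * ((z - x) \<bullet> ?m S) + \<theta>\<^sup>2 * a\<^sup>2 * (norm (?m S))\<^sup>2" for S
  proof -
    have "(norm (v - c *\<^sub>R m))\<^sup>2 = (norm v)\<^sup>2 - 2 * c * (v \<bullet> m) + c\<^sup>2 * (norm m)\<^sup>2"
      for v m :: "real^'d" and c
      unfolding power2_norm_eq_inner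
      by (simp add: inner_diff_left inner_diff_right inner_commute power2_eq_square)
    from this[of "z - x" "\<theta> * a" "?m S"] show ?thesis
      by (simp add: power_mult_distrib diff_diff_add add.commute)
  qed
  have "subset_mean k (\<lambda>S. 2 * a * p * \<theta>\<^sup>2 * (F (u - s *\<^sub>R ?m S) - F x)
        + (norm (z - (\<theta> * a) *\<^sub>R ?m S - x))\<^sup>2)
      = 2 * a * p * \<theta>\<^sup>2 * (f - F x) + ((norm (z - x))\<^sup>2 - 2 * \<theta> * a * (p * ((z - x) \<bullet> g))
        + \<theta>\<^sup>2 * a\<^sup>2 * (p * (norm g)\<^sup>2))"
    unfolding norm_step using k
    by (simp add: subset_mean_inner_mask subset_mean_norm_mask p_def f_def)
  also have "\<dots> = 2 * a * p * (\<theta>\<^sup>2 * (f - F x) - \<theta> * ((z - x) \<bullet> g) + \<theta>\<^sup>2 * (a / 2 * (norm g)\<^sup>2))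
      + (norm (z - x))\<^sup>2"
    by (simp add: algebra_simps power2_eq_square)
  also have "\<dots> \<le> 2 * a * p * (\<theta>\<^sup>2 * (F u - F x) - \<theta> * ((z - x) \<bullet> g)) + (norm (z - x))\<^sup>2"
  proof -
    have "\<theta>\<^sup>2 * (a / 2 * (norm g)\<^sup>2) \<le> \<theta>\<^sup>2 * (F u - f)"
      using descent by (intro mult_left_mono) (auto simp: f_def)
    then show ?thesis
      using p \<open>a \<ge> 0\<close> by (intro add_right_mono mult_left_mono) (auto simp: algebra_simps)
  qed
  also have "\<dots> \<le> 2 * a * p * (\<theta> * (\<theta> - 1) * (F w - F x)) + (norm (z - x))\<^sup>2"
  proof -
    \<comment> \<open>Since \<open>z - x = (\<theta> - 1) *\<^sub>R (u - w) + (u - x)\<close>, the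
      tangent inequality is used at \<open>w\<close> with weight \<open>\<theta> - 1\<close> and at
      \<open>x\<close> with weight 1.\<close>
    have "(\<theta> - 1) * (F u - F w) + (F u - F x) \<le> (\<theta> - 1) * (g \<bullet> (u - w)) + g \<bullet> (u - x)"
      using tangent[of w] tangent[of x] \<open>\<theta> \<ge> 1\<close>
      by (intro add_mono mult_left_mono) (auto simp: inner_diff_right)
    also have "\<dots> = (z - x) \<bullet> g"
      by (simp add: z_def inner_diff_left inner_diff_right inner_commute algebra_simps)
    finally have "\<theta> * ((\<theta> - 1) * (F u - F w) + (F u - F x)) \<le> \<theta> * ((z - x) \<bullet> g)"
      using \<open>\<theta> \<ge> 1\<close> by (intro mult_left_mono) auto
    then show ?thesis
      using p \<open>a \<ge> 0\<close>
      by (intro add_right_mono mult_left_mono) (auto simp: algebra_simps power2_eq_square)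
  qed
  finally show ?thesis
    by (simp add: mult.assoc)
qed

section \<open>Fresh samples and the accelerated rate\<close>

text \<open>A finite product of finite discrete spaces is discrete, so every function of finitely
  many samples is measurable, whatever the form of \<open>F\<close> or its gradient.\<close>

lemma measurable_fun_PiM_finite:
  fixes H :: "(nat \<Rightarrow> 'b::finite) \<Rightarrow> real"
  assumes "finite I"
  shows "H \<in> borel_measurable (PiM I (\<lambda>_. count_space UNIV))"
  using assms by (simp add: count_space_PiM_finite countable_finite)

text \<open>The bound is strict because iterate \<open>t\<close> is determined by the sets picked
  before iteration \<open>t\<close>. Restricting places the history in a finite function
  space.\<close>

abbreviation history :: "(nat \<Rightarrow> 'a \<Rightarrow> 'b) \<Rightarrow> nat \<Rightarrow> 'a \<Rightarrow> nat \<Rightarrow> 'b" where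
  "history S t \<omega> \<equiv> restrict (\<lambda>i. S i \<omega>) {1..<t}"

context prob_space
begin

context
  fixes S :: "nat \<Rightarrow> 'a \<Rightarrow> 'b::finite"
  assumes indep: "indep_vars (\<lambda>_. count_space UNIV) S {1..}"
begin

text \<open>For fixed \<open>t\<close> there are finitely many histories, so any function of them is
  bounded.\<close>

lemma integrable_history:
  fixes H :: "(nat \<Rightarrow> 'b) \<Rightarrow> real"
  shows "integrable M (\<lambda>\<omega>. H (history S t \<omega>))"
proof (rule integrable_const_bound)
  have "random_variable (count_space UNIV) (S i)" if "i \<in> {1..<t}" for i
    using indep that by (auto simp: indep_vars_def)
  then have "history S t \<in> M \<rightarrow>\<^sub>M PiM {1..<t} (\<lambda>_. count_space UNIV)"
    by (rule measurable_restrict)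
  then show "(\<lambda>\<omega>. H (history S t \<omega>)) \<in> borel_measurable M"
    using measurable_fun_PiM_finite[of "{1..<t}" H] by (rule measurable_compose) simp
  have "history S t \<omega> \<in> PiE {1..<t} (\<lambda>_. UNIV)" for \<omega>
    by auto
  then show "AE \<omega> in M. norm (H (history S t \<omega>))
      \<le> Max ((\<lambda>f. norm (H f)) ` PiE {1..<t} (\<lambda>_. UNIV))"
    by (intro AE_I2 Max_ge) (auto intro!: finite_PiE)
qed

text \<open>An elementary form of the tower rule: \<open>G\<close> is split over the finitely many
  values of \<open>S t\<close>, each product of a history function and an indicator factorizes by
  independence, and the sum is reassembled under the integral.\<close>

lemma expectation_history_fresh:
  fixes G :: "(nat \<Rightarrow> 'b) \<Rightarrow> 'b \<Rightarrow> real" and D :: "'b pmf"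
  assumes "t \<ge> 1" and distr: "distr M (count_space UNIV) (S t) = measure_pmf D"
  shows "expectation (\<lambda>\<omega>. G (history S t \<omega>) (S t \<omega>))
      = expectation (\<lambda>\<omega>. measure_pmf.expectation D (G (history S t \<omega>)))"
proof -
  let ?N = "\<lambda>I. PiM I (\<lambda>_ :: nat. count_space (UNIV :: 'b set))"
  have S_meas [measurable]: "S t \<in> M \<rightarrow>\<^sub>M count_space UNIV"
    using indep assms(1) by (auto simp: indep_vars_def)
  have ind: "indep_var borel (\<lambda>\<omega>. G (history S t \<omega>) A) borel (\<lambda>\<omega>. indicator {A} (S t \<omega>) :: real)"
    for A
  proof -
    \<comment> \<open>The past and the fresh set are blocks of the independent family over disjoint
      index sets.\<close>
    have "indep_var (?N {1..<t}) (history S t) (?N {t}) (\<lambda>\<omega>. restrict (\<lambda>i. S i \<omega>) {t})"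
      using assms(1) by (intro indep_var_restrict[OF indep]) auto
    from indep_var_compose[OF this measurable_fun_PiM_finite[of _ "\<lambda>h. G h A"]
        measurable_fun_PiM_finite[of _ "\<lambda>h. indicator {A} (h t)"]]
    show ?thesis
      by (simp add: comp_def)
  qed
  have int: "integrable M (\<lambda>\<omega>. indicator {A} (S t \<omega>) :: real)" for A
    by (rule integrable_const_bound[where B = 1]) (auto simp: indicator_def)
  have pmf: "expectation (\<lambda>\<omega>. indicator {A} (S t \<omega>)) = pmf D A" for A
  proof -
    have "expectation (\<lambda>\<omega>. indicator {A} (S t \<omega>))
        = integral\<^sup>L (distr M (count_space UNIV) (S t)) (indicator {A} :: _ \<Rightarrow> real)"
      by (rule integral_distr[OF S_meas, symmetric]) simp
    then show ?thesis
      by (simp add: distr pmf.rep_eq)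
  qed
  have "expectation (\<lambda>\<omega>. G (history S t \<omega>) (S t \<omega>))
      = expectation (\<lambda>\<omega>. \<Sum>A\<in>UNIV. G (history S t \<omega>) A * indicator {A} (S t \<omega>))"
    by (simp add: indicator_def)
  also have "\<dots> = (\<Sum>A\<in>UNIV. expectation (\<lambda>\<omega>. G (history S t \<omega>) A * indicator {A} (S t \<omega>)))"
    by (intro Bochner_Integration.integral_sum indep_var_integrable ind int integrable_history)
  also have "\<dots> = (\<Sum>A\<in>UNIV. expectation (\<lambda>\<omega>. G (history S t \<omega>) A) * pmf D A)"
    by (simp only: indep_var_lebesgue_integral[OF ind integrable_history int] pmf)
  also have "\<dots> = expectation (\<lambda>\<omega>. \<Sum>A\<in>UNIV. G (history S t \<omega>) A * pmf D A)"
    by (subst Bochner_Integration.integral_sum, rule integrable_mult_left, rule integrable_history)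
      simp
  also have "(\<lambda>\<omega>. \<Sum>A\<in>UNIV. G (history S t \<omega>) A * pmf D A)
      = (\<lambda>\<omega>. measure_pmf.expectation D (G (history S t \<omega>)))"
    by (rule ext, rule integral_measure_pmf_real[symmetric]) auto
  finally show ?thesis .
qed

end

end

theorem theorem2:
  fixes X :: "real^'d^'n"
    and y :: "'n \<Rightarrow> 'y"
    and loss :: "real \<Rightarrow> 'y \<Rightarrow> real"
    and F :: "real^'d \<Rightarrow> real"
    and \<beta> \<eta> \<rho> \<sigma> :: real
    and P t :: nat
    and \<gamma> c :: "nat \<Rightarrow> real"
    and M :: "'a measure"
    and S :: "nat \<Rightarrow> 'a \<Rightarrow> 'd set"
    and w u :: "nat \<Rightarrow> 'a \<Rightarrow> real^'d"
    and w1 wstar :: "real^'d"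
  assumes "CARD('d) \<ge> 2"
    and "\<And>j. (\<Sum>i\<in>UNIV. (X $ i $ j)\<^sup>2) = 1"
    and "\<beta> > 0"
    and "\<And>b. convex_on UNIV (\<lambda>a. loss a b)"
    and "\<And>a b. (\<lambda>z. loss z b) differentiable (at a)"
    and "\<And>a b. deriv (\<lambda>z. loss z b) differentiable (at a)"
    and "\<And>a b. deriv (deriv (\<lambda>z. loss z b)) a \<le> \<beta>"
    and "F = (\<lambda>v. \<Sum>i\<in>UNIV. loss (row i X \<bullet> v) (y i))"
    and "\<And>v. F wstar \<le> F v"
    and "\<rho> = spectral_radius (transpose X ** X)"
    and "1 \<le> P" and "P \<le> CARD('d)"
    and "\<eta> > 0"
    and "\<sigma> = (real P - 1) * (\<rho> - 1) / (real CARD('d) - 1)"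
    and "\<eta> / 2 * (1 + \<sigma>) < 1"
    and "\<And>t. t \<ge> 1 \<Longrightarrow> \<gamma> t = (1 - theta t) / theta (t + 1)"
    and "\<And>t. t \<ge> 1 \<Longrightarrow> c t = theta t / theta (t + 1) *
           (1 - 2 * real P / real CARD('d) * (1 - \<eta> / 2 * (1 + \<sigma>)))"
    and "prob_space M"
    and "uniform_coordinate_sets M P S"
    and "\<And>\<omega>. \<omega> \<in> space M \<Longrightarrow> w 1 \<omega> = w1"
    and "\<And>\<omega>. \<omega> \<in> space M \<Longrightarrow>
           accelerated_shotgun F \<eta> \<beta> \<gamma> c (\<lambda>t. S t \<omega>) (\<lambda>t. w t \<omega>) (\<lambda>t. u t \<omega>)"
    and "t > 1"
  shows "prob_space.expectation M (\<lambda>\<omega>. F (w t \<omega>)) - F wstar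
           \<le> \<beta> * (real CARD('d))\<^sup>2 * (norm (w1 - wstar))\<^sup>2
               / ((real t)\<^sup>2 * (real P)\<^sup>2 * \<eta> * (1 - \<eta> / 2 * (1 + \<sigma>)))"
proof -
  interpret prob_space M by fact
  note theta.simps(2) [simp del]

  \<comment> \<open>Constants, and the convexity and descent inequalities for
    \<open>F\<close>\<close>
  define \<kappa> where "\<kappa> = 1 - \<eta> / 2 * (1 + \<sigma>)"
  define p where "p = real P / real CARD('d)"
  define a where "a = 2 * p * \<kappa> * \<eta> / \<beta>"
  define A where "A = transpose X ** X"
  define G where "G = gradient F"
  note P = \<open>1 \<le> P\<close> \<open>P \<le> CARD('d)\<close>
  have "\<kappa> > 0" using \<open>\<eta> / 2 * (1 + \<sigma>) < 1\<close> by (simp add: \<kappa>_def)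
  have "p > 0" using P by (simp add: p_def)
  then have "a > 0" using \<open>\<kappa> > 0\<close> \<open>\<beta> > 0\<close> \<open>\<eta> > 0\<close> by (simp add: a_def)
  have A: "A $ i $ i = 1" "transpose A = A" for i
    using assms(2)[of i] by (simp_all add: A_def matrix_matrix_mult_def transpose_def
        power2_eq_square vec_eq_iff mult.commute)
  have tangent: "F v + G v \<bullet> (b - v) \<le> F b" for v b
    using convex_sum_ridge_above_tangent[of "\<lambda>i z. loss z (y i)" X v b] assms(4,5)
    by (simp add: assms(8) G_def)
  have smooth: "F (v + h) \<le> F v + G v \<bullet> h + \<beta> / 2 * (h \<bullet> (A *v h))" for v h
    using sum_ridge_quadratic_upper_bound[of "\<lambda>i z. loss z (y i)" \<beta> X v h] assms(5-7)
    by (simp add: assms(8) G_def A_def)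
  have descent: "subset_mean P (\<lambda>S. F (v - (\<eta> / \<beta>) *\<^sub>R mask_coords S (G v)))
      \<le> F v - a / 2 * (norm (G v))\<^sup>2" for v
  proof -
    have "a / 2 = real P / real CARD('d) * \<eta> / \<beta> * \<kappa>"
      by (simp add: a_def p_def)
    then show ?thesis
      using subset_mean_coordinate_step_le[OF P A \<open>\<beta> > 0\<close> smooth, of v \<eta>]
      unfolding \<kappa>_def assms(10,14) A_def by simp
  qed

  \<comment> \<open>The potential and the motion of its auxiliary point\<close>
  define z where "z = (\<lambda>t u w. theta t *\<^sub>R u - (theta t - 1) *\<^sub>R w :: real^'d)"
  \<comment> \<open>The shifted index matters at \<open>t = 1\<close>: \<open>theta 0 = 0\<close>
    removes the function value and \<open>theta 1 = 1\<close> reduces \<open>z\<close> to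
    \<open>u\<close>, so the initial potential is the squared distance to
    \<open>wstar\<close>.\<close>
  define V where "V = (\<lambda>t w u. 2 * a * p * (theta (t - 1))\<^sup>2 * (F w - F wstar) + (norm (z t u w - wstar))\<^sup>2)"
  have w_Suc: "w (Suc t) \<omega> = u t \<omega> - (\<eta> / \<beta>) *\<^sub>R mask_coords (S t \<omega>) (G (u t \<omega>))"
    and u_Suc: "u (Suc t) \<omega> = (1 - \<gamma> t) *\<^sub>R w (Suc t) \<omega> + \<gamma> t *\<^sub>R w t \<omega>
      + c t *\<^sub>R (u t \<omega> - w (Suc t) \<omega>)"
    if "t \<ge> 1" "\<omega> \<in> space M" for t \<omega>
    using assms(21)[OF that(2)] that(1)
    by (auto simp: accelerated_shotgun_def mask_coords_def vec_eq_iff G_def)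
  have z_Suc: "z (Suc t) (u (Suc t) \<omega>) (w (Suc t) \<omega>)
      = z t (u t \<omega>) (w t \<omega>) - (theta t * a) *\<^sub>R mask_coords (S t \<omega>) (G (u t \<omega>))"
    if t: "t \<ge> 1" "\<omega> \<in> space M" for t \<omega>
  proof -
    have "theta (Suc t) \<noteq> 0"
      using theta_Suc_ge[of t] by auto
    then have coeffs: "theta (Suc t) * \<gamma> t = 1 - theta t" "theta (Suc t) * c t = theta t * (1 - 2 * p * \<kappa>)"
      using assms(16)[OF t(1)] assms(17)[OF t(1)] by (auto simp: p_def \<kappa>_def)
    have "z (Suc t) (u (Suc t) \<omega>) (w (Suc t) \<omega>)
        = (1 - theta (Suc t) * \<gamma> t) *\<^sub>R w (Suc t) \<omega> + (theta (Suc t) * \<gamma> t) *\<^sub>R w t \<omega>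
          + (theta (Suc t) * c t) *\<^sub>R (u t \<omega> - w (Suc t) \<omega>)"
      unfolding z_def u_Suc[OF t] by (simp add: algebra_simps)
    \<comment> \<open>Of the coefficient \<open>theta t * (1 - 2 * p * \<kappa>)\<close>, the part
      \<open>theta t\<close> turns \<open>theta t *\<^sub>R w (Suc t) \<omega>\<close> into
      \<open>theta t *\<^sub>R u t \<omega>\<close>, which completes the old \<open>z\<close>; the
      rest is the displacement.\<close>
    also have "\<dots> = z t (u t \<omega>) (w t \<omega>) - (theta t * (2 * p * \<kappa>)) *\<^sub>R (u t \<omega> - w (Suc t) \<omega>)"
      unfolding coeffs by (simp add: z_def algebra_simps)
    also have "u t \<omega> - w (Suc t) \<omega> = (\<eta> / \<beta>) *\<^sub>R mask_coords (S t \<omega>) (G (u t \<omega>))"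
      by (simp add: w_Suc[OF t])
    finally show ?thesis
      by (simp add: a_def)
  qed

  \<comment> \<open>Iterates as functions of the history, and integrability\<close>
  have indep: "indep_vars (\<lambda>_. count_space UNIV) S {1..}"
    and law: "\<And>t. t \<ge> 1 \<Longrightarrow> distr M (count_space UNIV) (S t) = measure_pmf (pmf_of_set {A. card A = P})"
    using \<open>uniform_coordinate_sets M P S\<close> by (auto simp: uniform_coordinate_sets_def)
  have adapted: "\<exists>W U. \<forall>\<omega>\<in>space M. w (Suc t) \<omega> = W (history S (Suc t) \<omega>) \<and> u (Suc t) \<omega> = U (history S (Suc t) \<omega>)"
    for t
  proof (induction t)
    case 0
    have "w 1 \<omega> = w1 \<and> u 1 \<omega> = w1" if "\<omega> \<in> space M" for \<omega>
      using assms(20,21)[OF that] by (auto simp: accelerated_shotgun_def)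
    then show ?case
      by (intro exI[of _ "\<lambda>_. w1"]) auto
  next
    case (Suc t)
    define n where "n = Suc t"
    obtain W U where WU: "\<And>\<omega>. \<omega> \<in> space M \<Longrightarrow> w n \<omega> = W (history S n \<omega>)"
      "\<And>\<omega>. \<omega> \<in> space M \<Longrightarrow> u n \<omega> = U (history S n \<omega>)"
      using Suc unfolding n_def by blast
    \<comment> \<open>The longer history is cut back to recover the previous iterates, and its last
      entry \<open>f n\<close> supplies the fresh set.\<close>
    define W' where "W' = (\<lambda>f. U (restrict f {1..<n})
      - (\<eta> / \<beta>) *\<^sub>R mask_coords (f n) (G (U (restrict f {1..<n}))))"
    define U' where "U' = (\<lambda>f. (1 - \<gamma> n) *\<^sub>R W' f + \<gamma> n *\<^sub>R W (restrict f {1..<n})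
      + c n *\<^sub>R (U (restrict f {1..<n}) - W' f))"
    have r: "restrict (history S (Suc n) \<omega>) {1..<n} = history S n \<omega>" for \<omega>
      by (auto simp: restrict_def fun_eq_iff)
    have f: "history S (Suc n) \<omega> n = S n \<omega>" for \<omega>
      by (simp add: n_def)
    have "n \<ge> 1" by (simp add: n_def)
    have W: "w (Suc n) \<omega> = W' (history S (Suc n) \<omega>)" if "\<omega> \<in> space M" for \<omega>
      unfolding W'_def r f w_Suc[OF \<open>n \<ge> 1\<close> that] WU(2)[OF that] ..
    have "u (Suc n) \<omega> = U' (history S (Suc n) \<omega>)" if "\<omega> \<in> space M" for \<omega>
      unfolding U'_def r u_Suc[OF \<open>n \<ge> 1\<close> that] WU[OF that] W[OF that] ..
    with W show ?case unfolding n_def[symmetric] by blast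
  qed
  have V_integrable: "integrable M (\<lambda>\<omega>. V (Suc n) (w (Suc n) \<omega>) (u (Suc n) \<omega>))"
    and F_integrable: "integrable M (\<lambda>\<omega>. F (w (Suc n) \<omega>))" for n
  proof -
    obtain W U where WU: "\<And>\<omega>. \<omega> \<in> space M \<Longrightarrow>
        w (Suc n) \<omega> = W (history S (Suc n) \<omega>) \<and> u (Suc n) \<omega> = U (history S (Suc n) \<omega>)"
      using adapted[of n] by blast
    show "integrable M (\<lambda>\<omega>. V (Suc n) (w (Suc n) \<omega>) (u (Suc n) \<omega>))"
      using integrable_history[OF indep, of "\<lambda>h. V (Suc n) (W h) (U h)" "Suc n"]
      by (rule Bochner_Integration.integrable_cong[THEN iffD1, rotated -1]) (simp_all add: WU)
    show "integrable M (\<lambda>\<omega>. F (w (Suc n) \<omega>))"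
      using integrable_history[OF indep, of "\<lambda>h. F (W h)" "Suc n"]
      by (rule Bochner_Integration.integrable_cong[THEN iffD1, rotated -1]) (simp_all add: WU)
  qed

  \<comment> \<open>Decrease of the expected potential\<close>
  have step: "expectation (\<lambda>\<omega>. V (Suc (Suc n)) (w (Suc (Suc n)) \<omega>) (u (Suc (Suc n)) \<omega>))
      \<le> expectation (\<lambda>\<omega>. V (Suc n) (w (Suc n) \<omega>) (u (Suc n) \<omega>))" for n
  proof -
    define t where "t = Suc n"
    have "t \<ge> 1" by (simp add: t_def)
    have "theta t \<ge> 1"
      using theta_Suc_ge[of n] by (simp add: t_def)
    obtain W U where WU: "\<And>\<omega>. \<omega> \<in> space M \<Longrightarrow> w t \<omega> = W (history S t \<omega>)"
        "\<And>\<omega>. \<omega> \<in> space M \<Longrightarrow> u t \<omega> = U (history S t \<omega>)"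
      using adapted[of n] unfolding t_def by blast
    \<comment> \<open>\<open>Q h S\<close> is the potential after the step, with the past
      \<open>h\<close> and the fresh set \<open>S\<close> as separate arguments. This is the form in
      which the fresh set can be averaged for a fixed past.\<close>
    define Q where "Q = (\<lambda>h S. 2 * a * p * (theta t)\<^sup>2
        * (F (U h - (\<eta> / \<beta>) *\<^sub>R mask_coords S (G (U h))) - F wstar)
        + (norm (z t (U h) (W h) - (theta t * a) *\<^sub>R mask_coords S (G (U h)) - wstar))\<^sup>2)"
    have Q_le: "subset_mean P (Q h) \<le> V t (W h) (U h)" for h
    proof -
      have "theta t * (theta t - 1) = (theta (t - 1))\<^sup>2"
        using theta_Suc_recurrence[of n] by (simp add: t_def)
      then show ?thesis
        using subset_mean_potential_step_le[OF P tangent descent,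
            where \<theta> = "theta t" and w = "W h" and x = wstar, of "U h"]
          \<open>a > 0\<close> \<open>theta t \<ge> 1\<close>
        by (simp add: Q_def V_def z_def p_def)
    qed
    have "V (Suc t) (w (Suc t) \<omega>) (u (Suc t) \<omega>) = Q (history S t \<omega>) (S t \<omega>)"
      if \<omega>: "\<omega> \<in> space M" for \<omega>
      unfolding V_def z_Suc[OF \<open>t \<ge> 1\<close> \<omega>] unfolding w_Suc[OF \<open>t \<ge> 1\<close> \<omega>] Q_def WU[OF \<omega>]
      by simp
    then have "expectation (\<lambda>\<omega>. V (Suc t) (w (Suc t) \<omega>) (u (Suc t) \<omega>))
        = expectation (\<lambda>\<omega>. Q (history S t \<omega>) (S t \<omega>))"
      by (intro Bochner_Integration.integral_cong refl)
    also have "\<dots> = expectation (\<lambda>\<omega>. subset_mean P (Q (history S t \<omega>)))"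
      by (rule expectation_history_fresh[OF indep \<open>t \<ge> 1\<close> law[OF \<open>t \<ge> 1\<close>]])
    also have "\<dots> \<le> expectation (\<lambda>\<omega>. V t (W (history S t \<omega>)) (U (history S t \<omega>)))"
      by (intro integral_mono Q_le integrable_history[OF indep, of "\<lambda>h. subset_mean P (Q h)"]
          integrable_history[OF indep, of "\<lambda>h. V t (W h) (U h)"])
    also have "\<dots> = expectation (\<lambda>\<omega>. V t (w t \<omega>) (u t \<omega>))"
      by (intro Bochner_Integration.integral_cong refl) (simp add: WU)
    finally show ?thesis by (simp only: t_def)
  qed
  have V_le: "expectation (\<lambda>\<omega>. V (Suc n) (w (Suc n) \<omega>) (u (Suc n) \<omega>)) \<le> (norm (w1 - wstar))\<^sup>2" for n
  proof (induction n)
    case 0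
    have "V 1 (w 1 \<omega>) (u 1 \<omega>) = (norm (w1 - wstar))\<^sup>2" if "\<omega> \<in> space M" for \<omega>
      using assms(20,21)[OF that] by (auto simp: accelerated_shotgun_def V_def z_def scaleR_left_diff_distrib)
    then have "expectation (\<lambda>\<omega>. V 1 (w 1 \<omega>) (u 1 \<omega>)) = expectation (\<lambda>_. (norm (w1 - wstar))\<^sup>2)"
      by (intro Bochner_Integration.integral_cong) auto
    then show ?case
      by (simp add: prob_space)
  next
    case (Suc n)
    then show ?case using step[of n] by linarith
  qed

  \<comment> \<open>From the potential to the rate\<close>
  obtain n where n: "t = Suc (Suc n)"
    using \<open>t > 1\<close> by (metis One_nat_def less_imp_Suc_add add_Suc)
  define e where "e = expectation (\<lambda>\<omega>. F (w t \<omega>)) - F wstar"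
  have "e \<ge> 0"
    unfolding e_def using assms(9) F_integrable[of "Suc n"] n
    by (simp add: integral_ge_const)
  \<comment> \<open>As \<open>t = n + 2\<close>, the growth bound for \<open>theta (Suc n)\<close>
    is exactly \<open>real t / 2\<close>. Lowering the weight requires \<open>e \<ge> 0\<close>,
    which is where the minimality of \<open>wstar\<close> enters.\<close>
  have "2 * a * p * (real t / 2)\<^sup>2 * e \<le> 2 * a * p * (theta (t - 1))\<^sup>2 * e"
    using \<open>e \<ge> 0\<close> \<open>a > 0\<close> \<open>p > 0\<close> theta_Suc_ge[of n] n
    by (intro mult_left_mono mult_right_mono power_mono) auto
  also have "\<dots> = expectation (\<lambda>\<omega>. 2 * a * p * (theta (t - 1))\<^sup>2 * (F (w t \<omega>) - F wstar))"
    using F_integrable[of "Suc n"] n by (simp add: e_def prob_space)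
  also have "\<dots> \<le> expectation (\<lambda>\<omega>. V t (w t \<omega>) (u t \<omega>))"
    using F_integrable[of "Suc n"] V_integrable[of "Suc n"] unfolding n[symmetric]
    by (intro integral_mono) (auto simp: V_def)
  also have "\<dots> \<le> (norm (w1 - wstar))\<^sup>2"
    using V_le[of "Suc n"] by (simp only: n)
  finally have "2 * a * p * (real t / 2)\<^sup>2 * e \<le> (norm (w1 - wstar))\<^sup>2" .
  also have "2 * a * p * (real t / 2)\<^sup>2 = ((real t)\<^sup>2 * (real P)\<^sup>2 * \<eta> * \<kappa>) / (\<beta> * (real CARD('d))\<^sup>2)"
    using \<open>\<beta> > 0\<close> by (simp add: a_def p_def power2_eq_square field_simps)
  finally show ?thesis
    using \<open>\<beta> > 0\<close> \<open>\<kappa> > 0\<close> \<open>\<eta> > 0\<close> P \<open>t > 1\<close>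
    unfolding e_def[symmetric] \<kappa>_def[symmetric]
    by (simp add: field_simps)
qed

end
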